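(* Let $\mathfrak{C}$ be a concrete category with forgetful functor $|\cdot|\colon\mathfrak{C}\to\mathfrak{Ens}$, let $\mathbf{F}\colon\mathfrak{Ens}\to\mathfrak{C}$ be a left adjoint to $|\cdot|$, and let $\mathbb{M}$ be a monoid. Then the functor $\mathbf{F}^{\mathbb{M}}\circ\zeta\colon\mathfrak{Ens}\to\mathfrak{C}^{\mathbb{M}}$ is left adjoint to the canonical forgetful functor from $\mathfrak{C}^{\mathbb{M}}$ to $\mathfrak{Ens}$.
   Context: $\mathfrak{Ens}$ is the category of nonempty sets with arbitrary mappings. A concrete category is a category $\mathfrak{C}$ with a faithful (forgetful) functor $|\cdot|\colon\mathfrak{C}\to\mathfrak{Ens}$. For a category $\mathfrak{K}$, $\mathfrak{K}^{\mathbb{M}}$ is the category of $\mathbb{M}$-actions in $\mathfrak{K}$: objects are pairs $\langle A,\phi\rangle$ with $A$ an object of $\mathfrak{K}$ and $\phi\colon\mathbb{M}\to\operatorname{End}(A)$ a monoid homomorphism; morphisms from $\langle A,\phi\rangle$ to $\langle B,\psi\rangle$ are the $\mathfrak{K}$-arrows $g\colon A\to B$ with $g\circ\phi(m)=\psi(m)\circ g$ for all $m\in\mathbb{M}$. The canonical forgetful functor $\mathfrak{C}^{\mathbb{M}}\to\mathfrak{Ens}$ sends $\langle A,\phi\rangle$ to $|A|$ and a morphism $g$ to $|g|$. The functor $\zeta\colon\mathfrak{Ens}\to\mathfrak{Ens}^{\mathbb{M}}$ is given by $\zeta S=\langle\mathbb{M}\times S,\zeta_S\rangle$, where $\zeta_S(m)\langle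 a,s\rangle=\langle m\cdot a,s\rangle$, and, for $f\colon S\to T$, $\zeta f\langle a,s\rangle=\langle a,f(s)\rangle$. The functor $\mathbf{F}^{\mathbb{M}}\colon\mathfrak{Ens}^{\mathbb{M}}\to\mathfrak{C}^{\mathbb{M}}$ is given by $\mathbf{F}^{\mathbb{M}}\langle X,\phi\rangle=\langle\mathbf{F}X,\mathbf{F}\phi\rangle$, where $(\mathbf{F}\phi)(m)=\mathbf{F}(\phi(m))$, and $\mathbf{F}^{\mathbb{M}}f=\mathbf{F}f$ on morphisms. *)

theory Defs
  imports "HOL-Algebra.Group" "HOL-Library.Nat_Bijection"
begin

section \<open>Categories, functors and adjunctions\<close>

text \<open>
  Categories are given by hom-sets. These need not be disjoint, so composition and the arrow part
  of a functor take the objects involved as arguments: \<open>Cmp C X Y Z g f\<close> is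
  \<open>g \<circ> f\<close> for \<open>f : X \<rightarrow> Y\<close> and \<open>g : Y \<rightarrow> Z\<close>, and
  \<open>ArrMap F X Y f\<close> is the image of \<open>f : X \<rightarrow> Y\<close>. One and the same arrow of
  a category may thus be a morphism between several different actions.
\<close>

record ('o, 'a) cat =
  Obj :: "'o set"
  Hom :: "'o \<Rightarrow> 'o \<Rightarrow> 'a set"
  Idn :: "'o \<Rightarrow> 'a"
  Cmp :: "'o \<Rightarrow> 'o \<Rightarrow> 'o \<Rightarrow> 'a \<Rightarrow> 'a \<Rightarrow> 'a"

locale category =
  fixes C :: "('o, 'a) cat"
  assumes Idn_in_Hom: "X \<in> Obj C \<Longrightarrow> Idn C X \<in> Hom C X X"
    and Cmp_in_Hom:
      "\<lbrakk>X \<in> Obj C; Y \<in> Obj C; Z \<in> Obj C; f \<in> Hom C X Y; g \<in> Hom C Y Z\<rbrakk>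
        \<Longrightarrow> Cmp C X Y Z g f \<in> Hom C X Z"
    and Cmp_Idn_left:
      "\<lbrakk>X \<in> Obj C; Y \<in> Obj C; f \<in> Hom C X Y\<rbrakk> \<Longrightarrow> Cmp C X Y Y (Idn C Y) f = f"
    and Cmp_Idn_right:
      "\<lbrakk>X \<in> Obj C; Y \<in> Obj C; f \<in> Hom C X Y\<rbrakk> \<Longrightarrow> Cmp C X X Y f (Idn C X) = f"
    and Cmp_assoc:
      "\<lbrakk>W \<in> Obj C; X \<in> Obj C; Y \<in> Obj C; Z \<in> Obj C;
        f \<in> Hom C W X; g \<in> Hom C X Y; h \<in> Hom C Y Z\<rbrakk>
        \<Longrightarrow> Cmp C W X Z (Cmp C X Y Z h g) f = Cmp C W Y Z h (Cmp C W X Y g f)"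

record ('o, 'a, 'p, 'b) fctr =
  ObjMap :: "'o \<Rightarrow> 'p"
  ArrMap :: "'o \<Rightarrow> 'o \<Rightarrow> 'a \<Rightarrow> 'b"

locale cat_functor = dom: category C + cod: category D
  for C :: "('o, 'a) cat" and D :: "('p, 'b) cat" +
  fixes F :: "('o, 'a, 'p, 'b) fctr"
  assumes ObjMap_in_Obj: "X \<in> Obj C \<Longrightarrow> ObjMap F X \<in> Obj D"
    and ArrMap_in_Hom:
      "\<lbrakk>X \<in> Obj C; Y \<in> Obj C; f \<in> Hom C X Y\<rbrakk>
        \<Longrightarrow> ArrMap F X Y f \<in> Hom D (ObjMap F X) (ObjMap F Y)"
    and ArrMap_Idn: "X \<in> Obj C \<Longrightarrow> ArrMap F X X (Idn C X) = Idn D (ObjMap F X)"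
    and ArrMap_Cmp:
      "\<lbrakk>X \<in> Obj C; Y \<in> Obj C; Z \<in> Obj C; f \<in> Hom C X Y; g \<in> Hom C Y Z\<rbrakk>
        \<Longrightarrow> ArrMap F X Z (Cmp C X Y Z g f) =
            Cmp D (ObjMap F X) (ObjMap F Y) (ObjMap F Z) (ArrMap F Y Z g) (ArrMap F X Y f)"

definition fctr_comp ::
  "('p, 'b, 'q, 'c) fctr \<Rightarrow> ('o, 'a, 'p, 'b) fctr \<Rightarrow> ('o, 'a, 'q, 'c) fctr"
  where "fctr_comp G F =
    \<lparr>ObjMap = \<lambda>X. ObjMap G (ObjMap F X),
     ArrMap = \<lambda>X Y f. ArrMap G (ObjMap F X) (ObjMap F Y) (ArrMap F X Y f)\<rparr>"

text \<open>
  \<open>left_adjoint D C F G\<close>: the functor \<open>F : D \<rightarrow> C\<close> is left adjoint to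
  \<open>G : C \<rightarrow> D\<close>, i.e. there are bijections from \<open>Hom C (F X) A\<close> to
  \<open>Hom D X (G A)\<close>, natural in \<open>X\<close> and \<open>A\<close>; the last conjunct says
  that \<open>k \<circ> g \<circ> F h\<close> corresponds to \<open>G k \<circ> \<Phi> g \<circ> h\<close>.
\<close>

definition left_adjoint ::
  "('o, 'a) cat \<Rightarrow> ('p, 'b) cat \<Rightarrow> ('o, 'a, 'p, 'b) fctr \<Rightarrow> ('p, 'b, 'o, 'a) fctr \<Rightarrow> bool"
  where "left_adjoint D C F G \<longleftrightarrow>
    cat_functor D C F \<and> cat_functor C D G \<and>
    (\<exists>\<Phi>.
      (\<forall>X\<in>Obj D. \<forall>A\<in>Obj C.
        bij_betw (\<Phi> X A) (Hom C (ObjMap F X) A) (Hom D X (ObjMap G A))) \<and>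
      (\<forall>X\<in>Obj D. \<forall>X'\<in>Obj D. \<forall>A\<in>Obj C. \<forall>A'\<in>Obj C.
        \<forall>h\<in>Hom D X' X. \<forall>k\<in>Hom C A A'. \<forall>g\<in>Hom C (ObjMap F X) A.
          \<Phi> X' A' (Cmp C (ObjMap F X') A A' k
                     (Cmp C (ObjMap F X') (ObjMap F X) A g (ArrMap F X' X h))) =
          Cmp D X' (ObjMap G A) (ObjMap G A') (ArrMap G A A' k)
            (Cmp D X' X (ObjMap G A) (\<Phi> X A g) h)))"


section \<open>Nonempty sets and concrete categories\<close>

text \<open>
  A HOL type has no set of all sets, so sets are taken from a universe \<open>U\<close> of subsets of a
  type \<open>'u\<close>. The only closure property needed here is that \<open>U\<close> has binary
  products, formed with an ordered pair \<open>pr\<close> that is injective on the elements of members of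
  \<open>U\<close>. All sets of a model of set theory (with Kuratowski pairs), a Grothendieck universe,
  or all subsets of an infinite type (with an injection \<open>'u \<times> 'u \<rightarrow> 'u\<close>)
  are instances.
\<close>

locale set_universe =
  fixes U :: "'u set set" and pr :: "'u \<times> 'u \<Rightarrow> 'u"
  assumes inj_pr: "inj_on pr (\<Union>U \<times> \<Union>U)"
    and prod_in_U: "\<lbrakk>S \<in> U; T \<in> U\<rbrakk> \<Longrightarrow> pr ` (S \<times> T) \<in> U"

lemma set_universe_nat: "set_universe UNIV prod_encode"
  by unfold_locales (auto intro: inj_on_subset[OF inj_prod_encode])

definition Ens :: "'u set set \<Rightarrow> ('u set, 'u \<Rightarrow> 'u) cat"
  where "Ens U =
    \<lparr>Obj = {S \<in> U. S \<noteq> {}},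
     Hom = \<lambda>S T. S \<rightarrow>\<^sub>E T,
     Idn = \<lambda>S. \<lambda>x\<in>S. x,
     Cmp = \<lambda>R S T g f. compose R g f\<rparr>"

locale concrete_category = cat_functor C "Ens U" V
  for U :: "'u set set" and C :: "('o, 'a) cat" and V :: "('o, 'a, 'u set, 'u \<Rightarrow> 'u) fctr" +
  assumes faithful: "\<lbrakk>A \<in> Obj C; B \<in> Obj C\<rbrakk> \<Longrightarrow> inj_on (ArrMap V A B) (Hom C A B)"


section \<open>Monoid actions\<close>

definition End :: "('o, 'a) cat \<Rightarrow> 'o \<Rightarrow> 'a monoid"
  where "End K A = \<lparr>carrier = Hom K A A, mult = Cmp K A A A, one = Idn K A\<rparr>"

text \<open>
  In \<open>HOL-Algebra\<close>, \<open>hom\<close> does not require preservation of the unit. Maps out of the monoid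
  are made extensional so that equal actions are equal as HOL objects.
\<close>

definition action_cat :: "('m, 'z) monoid_scheme \<Rightarrow> ('o, 'a) cat \<Rightarrow> ('o \<times> ('m \<Rightarrow> 'a), 'a) cat"
  where "action_cat M K =
    \<lparr>Obj = {(A, \<phi>). A \<in> Obj K \<and> \<phi> \<in> extensional (carrier M) \<and>
                      \<phi> \<in> hom M (End K A) \<and> \<phi> \<one>\<^bsub>M\<^esub> = \<one>\<^bsub>End K A\<^esub>},
     Hom = \<lambda>(A, \<phi>) (B, \<psi>).
             {g \<in> Hom K A B. \<forall>m\<in>carrier M. Cmp K A A B g (\<phi> m) = Cmp K A B B (\<psi> m) g},
     Idn = \<lambda>(A, \<phi>). Idn K A,
     Cmp = \<lambda>(A, \<phi>) (B, \<psi>) (D, \<chi>). Cmp K A B D\<rparr>"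

definition action_forget ::
  "('o, 'a, 'p, 'b) fctr \<Rightarrow> ('o \<times> ('m \<Rightarrow> 'a), 'a, 'p, 'b) fctr"
  where "action_forget V =
    \<lparr>ObjMap = \<lambda>(A, \<phi>). ObjMap V A,
     ArrMap = \<lambda>(A, \<phi>) (B, \<psi>). ArrMap V A B\<rparr>"

definition action_fctr ::
  "('m, 'z) monoid_scheme \<Rightarrow> ('o, 'a, 'p, 'b) fctr
    \<Rightarrow> ('o \<times> ('m \<Rightarrow> 'a), 'a, 'p \<times> ('m \<Rightarrow> 'b), 'b) fctr"
  where "action_fctr M F =
    \<lparr>ObjMap = \<lambda>(X, \<phi>). (ObjMap F X, \<lambda>m\<in>carrier M. ArrMap F X X (\<phi> m)),
     ArrMap = \<lambda>(X, \<phi>) (Y, \<psi>). ArrMap F X Y\<rparr>"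

text \<open>
  The product of the monoid with \<open>S\<close> is \<open>pr ` (carrier M \<times> S)\<close>, and
  \<open>inv_into\<close> recovers \<open>(a, s)\<close> from \<open>pr (a, s)\<close>. Thus
  \<open>zeta_act pr M S m\<close> sends \<open>pr (a, s)\<close> to \<open>pr (m \<otimes> a, s)\<close>, and \<open>zeta\<close> sends \<open>f\<close> to
  the map taking \<open>pr (a, s)\<close> to \<open>pr (a, f s)\<close>.
\<close>

definition zeta_act ::
  "('u \<times> 'u \<Rightarrow> 'u) \<Rightarrow> ('u, 'z) monoid_scheme \<Rightarrow> 'u set \<Rightarrow> 'u \<Rightarrow> 'u \<Rightarrow> 'u"
  where "zeta_act pr M S =
    (\<lambda>m\<in>carrier M. \<lambda>x\<in>pr ` (carrier M \<times> S).
       case inv_into (carrier M \<times> S) pr x of (a, s) \<Rightarrow> pr (m \<otimes>\<^bsub>M\<^esub> a, s))"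

definition zeta ::
  "('u \<times> 'u \<Rightarrow> 'u) \<Rightarrow> ('u, 'z) monoid_scheme
    \<Rightarrow> ('u set, 'u \<Rightarrow> 'u, 'u set \<times> ('u \<Rightarrow> 'u \<Rightarrow> 'u), 'u \<Rightarrow> 'u) fctr"
  where "zeta pr M =
    \<lparr>ObjMap = \<lambda>S. (pr ` (carrier M \<times> S), zeta_act pr M S),
     ArrMap = \<lambda>S T f. \<lambda>x\<in>pr ` (carrier M \<times> S).
       case inv_into (carrier M \<times> S) pr x of (a, s) \<Rightarrow> pr (a, f s)\<rparr>"

end

theory Submission
  imports Defs
begin

text \<open>
  The adjunction is a composite of two. An action of \<open>M\<close> on a nonempty set is an action of
  \<open>M\<close> in \<open>Ens U\<close>, and the canonical forgetful functor factors as
  \<open>C\<^sup>M \<rightarrow> (Ens U)\<^sup>M \<rightarrow> Ens U\<close>: first apply \<open>V\<close> to an action,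
  then forget the action (\<open>action_forget_eq_fctr_comp\<close>). Since adjunctions compose
  (\<open>left_adjoint_fctr_comp\<close>), a left adjoint of each factor suffices.

  For the first factor, the bijection \<open>Hom (F X) A \<cong> Hom X (V A)\<close> of the given adjunction is
  natural, so it turns the two sides \<open>g \<circ> F (\<phi> m)\<close> and \<open>\<alpha> m \<circ> g\<close> of the equivariance
  condition for \<open>g\<close> into the two sides of the equivariance condition for its adjunct. Hence it
  restricts to a bijection between equivariant arrows (\<open>left_adjoint_action_fctr\<close>).

  For the second factor, \<open>zeta S\<close> is the free \<open>M\<close>-set on \<open>S\<close>: every element
  \<open>(a, s)\<close> of \<open>M \<times> S\<close> is \<open>a \<cdot> (\<one>, s)\<close>, so an equivariant map is determined by its
  values on the pairs \<open>(\<one>, s)\<close>, and these values can be prescribed (\<open>left_adjoint_zeta\<close>).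
\<close>

section \<open>Functors and adjunctions\<close>

lemma cat_functor_fctr_comp:
  assumes "cat_functor C D F" and "cat_functor D E G"
  shows "cat_functor C E (fctr_comp G F)"
proof -
  interpret F: cat_functor C D F by fact
  interpret G: cat_functor D E G by fact
  show ?thesis
    by unfold_locales
      (simp_all add: fctr_comp_def F.ObjMap_in_Obj F.ArrMap_in_Hom F.ArrMap_Idn F.ArrMap_Cmp
        G.ObjMap_in_Obj G.ArrMap_in_Hom G.ArrMap_Idn G.ArrMap_Cmp)
qed

text \<open>
  \<^const>\<open>left_adjoint\<close> hides the family of bijections behind an existential quantifier; the
  locale names it, so that its naturality can be used one variable at a time.
\<close>

locale adjunction = F: cat_functor D C F + G: cat_functor C D G
  for D :: "('o, 'a) cat" and C :: "('p, 'b) cat"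
    and F :: "('o, 'a, 'p, 'b) fctr" and G :: "('p, 'b, 'o, 'a) fctr" +
  fixes \<Phi> :: "'o \<Rightarrow> 'p \<Rightarrow> 'b \<Rightarrow> 'a"
  assumes bij: "\<lbrakk>X \<in> Obj D; A \<in> Obj C\<rbrakk>
      \<Longrightarrow> bij_betw (\<Phi> X A) (Hom C (ObjMap F X) A) (Hom D X (ObjMap G A))"
    and natural: "\<lbrakk>X \<in> Obj D; X' \<in> Obj D; A \<in> Obj C; A' \<in> Obj C;
        h \<in> Hom D X' X; k \<in> Hom C A A'; g \<in> Hom C (ObjMap F X) A\<rbrakk> \<Longrightarrow>
          \<Phi> X' A' (Cmp C (ObjMap F X') A A' k
                     (Cmp C (ObjMap F X') (ObjMap F X) A g (ArrMap F X' X h))) =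
          Cmp D X' (ObjMap G A) (ObjMap G A') (ArrMap G A A' k)
            (Cmp D X' X (ObjMap G A) (\<Phi> X A g) h)"
begin

lemma adjunct_in_Hom:
  "\<lbrakk>X \<in> Obj D; A \<in> Obj C; g \<in> Hom C (ObjMap F X) A\<rbrakk> \<Longrightarrow> \<Phi> X A g \<in> Hom D X (ObjMap G A)"
  using bij bij_betwE by blast

lemma natural_left:
  assumes "X \<in> Obj D" "X' \<in> Obj D" "A \<in> Obj C" "h \<in> Hom D X' X" "g \<in> Hom C (ObjMap F X) A"
  shows "\<Phi> X' A (Cmp C (ObjMap F X') (ObjMap F X) A g (ArrMap F X' X h)) =
    Cmp D X' X (ObjMap G A) (\<Phi> X A g) h"
proof -
  have "Cmp C (ObjMap F X') (ObjMap F X) A g (ArrMap F X' X h) \<in> Hom C (ObjMap F X') A"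
    using assms by (auto intro: F.cod.Cmp_in_Hom F.ArrMap_in_Hom F.ObjMap_in_Obj)
  moreover have "Cmp D X' X (ObjMap G A) (\<Phi> X A g) h \<in> Hom D X' (ObjMap G A)"
    using assms by (auto intro: F.dom.Cmp_in_Hom adjunct_in_Hom G.ObjMap_in_Obj)
  ultimately show ?thesis
    using natural[of X X' A A h "Idn C A" g] assms
    by (simp add: F.cod.Idn_in_Hom F.cod.Cmp_Idn_left F.dom.Cmp_Idn_left
        F.ObjMap_in_Obj G.ObjMap_in_Obj G.ArrMap_Idn)
qed

lemma natural_right:
  assumes "X \<in> Obj D" "A \<in> Obj C" "A' \<in> Obj C" "k \<in> Hom C A A'" "g \<in> Hom C (ObjMap F X) A"
  shows "\<Phi> X A' (Cmp C (ObjMap F X) A A' k g) =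
    Cmp D X (ObjMap G A) (ObjMap G A') (ArrMap G A A' k) (\<Phi> X A g)"
  using natural[of X X A A' "Idn D X" k g] assms
  by (simp add: F.cod.Cmp_Idn_right F.dom.Cmp_Idn_right F.dom.Idn_in_Hom F.ArrMap_Idn
      F.ObjMap_in_Obj G.ObjMap_in_Obj adjunct_in_Hom)

end

lemma left_adjoint_iff_adjunction: "left_adjoint D C F G \<longleftrightarrow> (\<exists>\<Phi>. adjunction D C F G \<Phi>)"
  unfolding left_adjoint_def adjunction_def adjunction_axioms_def by blast

text \<open>
  The adjuncts for the composite are found in two steps,
  \<open>Hom (F' (F X)) A \<cong> Hom (F X) (G' A) \<cong> Hom X (G (G' A))\<close>.
\<close>

lemma left_adjoint_fctr_comp:
  assumes "left_adjoint D E F G" and "left_adjoint E C F' G'"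
  shows "left_adjoint D C (fctr_comp F' F) (fctr_comp G G')"
proof -
  from assms obtain \<Phi> \<Psi> where "adjunction D E F G \<Phi>" and "adjunction E C F' G' \<Psi>"
    by (auto simp: left_adjoint_iff_adjunction)
  then interpret A: adjunction D E F G \<Phi> + B: adjunction E C F' G' \<Psi> by auto
  have "adjunction D C (fctr_comp F' F) (fctr_comp G G')
      (\<lambda>X A g. \<Phi> X (ObjMap G' A) (\<Psi> (ObjMap F X) A g))"
  proof (intro adjunction.intro adjunction_axioms.intro)
    show "cat_functor D C (fctr_comp F' F)" "cat_functor C D (fctr_comp G G')"
      by (blast intro: cat_functor_fctr_comp A.F.cat_functor_axioms A.G.cat_functor_axioms
          B.F.cat_functor_axioms B.G.cat_functor_axioms)+
  next
    fix X A assume "X \<in> Obj D" "A \<in> Obj C"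
    then have "bij_betw (\<Phi> X (ObjMap G' A) \<circ> \<Psi> (ObjMap F X) A)
        (Hom C (ObjMap F' (ObjMap F X)) A) (Hom D X (ObjMap G (ObjMap G' A)))"
      by (intro bij_betw_trans[OF B.bij A.bij] A.F.ObjMap_in_Obj B.G.ObjMap_in_Obj)
    then show "bij_betw (\<lambda>g. \<Phi> X (ObjMap G' A) (\<Psi> (ObjMap F X) A g))
        (Hom C (ObjMap (fctr_comp F' F) X) A) (Hom D X (ObjMap (fctr_comp G G') A))"
      by (simp add: fctr_comp_def comp_def)
  next
    fix X X' A A' h k g
    assume "X \<in> Obj D" "X' \<in> Obj D" "A \<in> Obj C" "A' \<in> Obj C" "h \<in> Hom D X' X"
      "k \<in> Hom C A A'" "g \<in> Hom C (ObjMap (fctr_comp F' F) X) A"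
    then show "\<Phi> X' (ObjMap G' A') (\<Psi> (ObjMap F X') A'
          (Cmp C (ObjMap (fctr_comp F' F) X') A A' k
             (Cmp C (ObjMap (fctr_comp F' F) X') (ObjMap (fctr_comp F' F) X) A g
                (ArrMap (fctr_comp F' F) X' X h)))) =
        Cmp D X' (ObjMap (fctr_comp G G') A) (ObjMap (fctr_comp G G') A')
          (ArrMap (fctr_comp G G') A A' k)
          (Cmp D X' X (ObjMap (fctr_comp G G') A)
             (\<Phi> X (ObjMap G' A) (\<Psi> (ObjMap F X) A g)) h)"
      by (simp add: fctr_comp_def A.natural B.natural B.adjunct_in_Hom A.F.ArrMap_in_Hom
          A.F.ObjMap_in_Obj B.G.ArrMap_in_Hom B.G.ObjMap_in_Obj)
  qed
  then show ?thesis by (auto simp: left_adjoint_iff_adjunction)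
qed


section \<open>Categories of actions\<close>

lemma mem_Obj_action_cat:
  "(A, \<phi>) \<in> Obj (action_cat M K) \<longleftrightarrow>
    A \<in> Obj K \<and> \<phi> \<in> extensional (carrier M) \<and> (\<forall>m\<in>carrier M. \<phi> m \<in> Hom K A A) \<and>
    (\<forall>m\<in>carrier M. \<forall>n\<in>carrier M. \<phi> (m \<otimes>\<^bsub>M\<^esub> n) = Cmp K A A A (\<phi> m) (\<phi> n)) \<and>
    \<phi> \<one>\<^bsub>M\<^esub> = Idn K A"
  by (auto simp: action_cat_def End_def hom_def Pi_def)

lemma mem_Hom_action_cat:
  "g \<in> Hom (action_cat M K) (A, \<phi>) (B, \<psi>) \<longleftrightarrow>
    g \<in> Hom K A B \<and> (\<forall>m\<in>carrier M. Cmp K A A B g (\<phi> m) = Cmp K A B B (\<psi> m) g)"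
  by (simp add: action_cat_def)

lemma Idn_action_cat: "Idn (action_cat M K) (A, \<phi>) = Idn K A"
  by (simp add: action_cat_def)

lemma Cmp_action_cat: "Cmp (action_cat M K) (A, \<phi>) (B, \<psi>) (D, \<chi>) = Cmp K A B D"
  by (simp add: action_cat_def)

lemmas action_cat_simps =
  mem_Obj_action_cat mem_Hom_action_cat Idn_action_cat Cmp_action_cat

lemma category_action_cat:
  assumes "category K"
  shows "category (action_cat M K)"
proof -
  interpret category K by fact
  have Cmp_equivariant: "Cmp K A A D (Cmp K A B D g f) (\<phi> m) = Cmp K A D D (\<chi> m) (Cmp K A B D g f)"
    if "(A, \<phi>) \<in> Obj (action_cat M K)" "(B, \<psi>) \<in> Obj (action_cat M K)"
      "(D, \<chi>) \<in> Obj (action_cat M K)" "f \<in> Hom (action_cat M K) (A, \<phi>) (B, \<psi>)"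
      "g \<in> Hom (action_cat M K) (B, \<psi>) (D, \<chi>)" "m \<in> carrier M"
    for A B D \<phi> \<psi> \<chi> f g m
  proof -
    have "Cmp K A A D (Cmp K A B D g f) (\<phi> m) = Cmp K A B D g (Cmp K A A B f (\<phi> m))"
      using that by (intro Cmp_assoc) (auto simp: action_cat_simps)
    also have "\<dots> = Cmp K A B D g (Cmp K A B B (\<psi> m) f)"
      using that by (simp add: action_cat_simps)
    also have "\<dots> = Cmp K A B D (Cmp K B B D g (\<psi> m)) f"
      using that by (intro Cmp_assoc[symmetric]) (auto simp: action_cat_simps)
    also have "\<dots> = Cmp K A B D (Cmp K B D D (\<chi> m) g) f"
      using that by (simp add: action_cat_simps)
    also have "\<dots> = Cmp K A D D (\<chi> m) (Cmp K A B D g f)"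
      using that by (intro Cmp_assoc) (auto simp: action_cat_simps)
    finally show ?thesis .
  qed
  show ?thesis
  proof (unfold_locales, goal_cases)
    case (1 X)
    then show ?case
      by (cases X) (auto simp: action_cat_simps Idn_in_Hom Cmp_Idn_left Cmp_Idn_right)
  next
    case (2 X Y Z f g)
    then show ?case
      using Cmp_equivariant[of "fst X" "snd X" "fst Y" "snd Y" "fst Z" "snd Z" f g]
      by (cases X; cases Y; cases Z) (auto simp: action_cat_simps intro: Cmp_in_Hom)
  next
    case (3 X Y f)
    then show ?case by (cases X; cases Y) (auto simp: action_cat_simps Cmp_Idn_left)
  next
    case (4 X Y f)
    then show ?case by (cases X; cases Y) (auto simp: action_cat_simps Cmp_Idn_right)
  next
    case (5 W X Y Z f g h)
    then show ?case
      by (cases W; cases X; cases Y; cases Z) (auto simp: action_cat_simps intro: Cmp_assoc)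
  qed
qed

lemma ObjMap_action_fctr:
  "ObjMap (action_fctr M F) (A, \<phi>) = (ObjMap F A, \<lambda>m\<in>carrier M. ArrMap F A A (\<phi> m))"
  by (simp add: action_fctr_def)

lemma ArrMap_action_fctr: "ArrMap (action_fctr M F) (A, \<phi>) (B, \<psi>) = ArrMap F A B"
  by (simp add: action_fctr_def)

lemmas action_fctr_simps = ObjMap_action_fctr ArrMap_action_fctr

lemma cat_functor_action_fctr:
  assumes "monoid M" and "cat_functor C D F"
  shows "cat_functor (action_cat M C) (action_cat M D) (action_fctr M F)"
proof -
  interpret M: monoid M by fact
  interpret cat_functor C D F by fact
  show ?thesis
  proof (intro cat_functor.intro cat_functor_axioms.intro category_action_cat
      dom.category_axioms cod.category_axioms, goal_cases)
    case (1 X)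
    then show ?case
      by (cases X) (auto simp: action_cat_simps action_fctr_simps ObjMap_in_Obj ArrMap_in_Hom
          ArrMap_Idn ArrMap_Cmp)
  next
    case (2 X Y f)
    obtain A \<phi> B \<psi> where [simp]: "X = (A, \<phi>)" "Y = (B, \<psi>)" by fastforce
    have "Cmp D (ObjMap F A) (ObjMap F A) (ObjMap F B) (ArrMap F A B f) (ArrMap F A A (\<phi> m)) =
        Cmp D (ObjMap F A) (ObjMap F B) (ObjMap F B) (ArrMap F B B (\<psi> m)) (ArrMap F A B f)"
      if "m \<in> carrier M" for m
      using 2 that ArrMap_Cmp[of A A B "\<phi> m" f] ArrMap_Cmp[of A B B f "\<psi> m"]
      by (auto simp: action_cat_simps)
    with 2 show ?case by (auto simp: action_cat_simps action_fctr_simps ArrMap_in_Hom)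
  next
    case (3 X)
    then show ?case by (cases X) (auto simp: action_cat_simps action_fctr_simps ArrMap_Idn)
  next
    case (4 X Y Z f g)
    then show ?case
      by (cases X; cases Y; cases Z) (auto simp: action_cat_simps action_fctr_simps ArrMap_Cmp)
  qed
qed

text \<open>
  An arrow \<open>g\<close> out of \<open>F X\<close> is equivariant if and only if its adjunct \<open>\<Phi> g\<close> is, because
  \<open>\<Phi> (g \<circ> F (\<phi> m)) = \<Phi> g \<circ> \<phi> m\<close> and \<open>\<Phi> (\<alpha> m \<circ> g) = V (\<alpha> m) \<circ> \<Phi> g\<close>. So the adjunction
  bijections restrict to equivariant arrows.
\<close>

lemma left_adjoint_action_fctr:
  assumes "monoid M" and "left_adjoint D C F G"
  shows "left_adjoint (action_cat M D) (action_cat M C) (action_fctr M F) (action_fctr M G)"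
proof -
  from assms(2) obtain \<Phi> where "adjunction D C F G \<Phi>"
    by (auto simp: left_adjoint_iff_adjunction)
  then interpret adjunction D C F G \<Phi> .
  have "adjunction (action_cat M D) (action_cat M C) (action_fctr M F) (action_fctr M G)
      (\<lambda>(X, \<phi>) (A, \<alpha>). \<Phi> X A)"
  proof (intro adjunction.intro adjunction_axioms.intro
      cat_functor_action_fctr assms(1) F.cat_functor_axioms G.cat_functor_axioms, goal_cases)
    case (1 X' A')
    obtain X \<phi> A \<alpha> where [simp]: "X' = (X, \<phi>)" "A' = (A, \<alpha>)" by fastforce
    have obj: "X \<in> Obj D" "A \<in> Obj C"
      and act: "\<And>m. m \<in> carrier M \<Longrightarrow> \<phi> m \<in> Hom D X X" "\<And>m. m \<in> carrier M \<Longrightarrow> \<alpha> m \<in> Hom C A A"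
      using 1 by (auto simp: action_cat_simps)
    note bij' = bij[OF obj]
    have equivariant_iff:
      "Cmp C (ObjMap F X) (ObjMap F X) A g (ArrMap F X X (\<phi> m)) = Cmp C (ObjMap F X) A A (\<alpha> m) g \<longleftrightarrow>
       Cmp D X X (ObjMap G A) (\<Phi> X A g) (\<phi> m) =
         Cmp D X (ObjMap G A) (ObjMap G A) (ArrMap G A A (\<alpha> m)) (\<Phi> X A g)"
      if g: "g \<in> Hom C (ObjMap F X) A" and m: "m \<in> carrier M" for g m
    proof -
      have "Cmp C (ObjMap F X) (ObjMap F X) A g (ArrMap F X X (\<phi> m)) \<in> Hom C (ObjMap F X) A"
        "Cmp C (ObjMap F X) A A (\<alpha> m) g \<in> Hom C (ObjMap F X) A"
        using obj act[OF m] g by (auto intro: F.cod.Cmp_in_Hom F.ArrMap_in_Hom F.ObjMap_in_Obj)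
      from inj_on_eq_iff[OF bij_betw_imp_inj_on[OF bij'] this] show ?thesis
        using natural_left[OF obj(1,1,2) act(1)[OF m] g]
          natural_right[OF obj(1,2,2) act(2)[OF m] g] by simp
    qed
    have "Hom (action_cat M C) (ObjMap (action_fctr M F) X') A' =
        {g \<in> Hom C (ObjMap F X) A. \<forall>m\<in>carrier M.
           Cmp C (ObjMap F X) (ObjMap F X) A g (ArrMap F X X (\<phi> m)) = Cmp C (ObjMap F X) A A (\<alpha> m) g}"
      by (auto simp: action_cat_simps action_fctr_simps)
    moreover have "Hom (action_cat M D) X' (ObjMap (action_fctr M G) A') =
        {f \<in> Hom D X (ObjMap G A). \<forall>m\<in>carrier M.
           Cmp D X X (ObjMap G A) f (\<phi> m) =
             Cmp D X (ObjMap G A) (ObjMap G A) (ArrMap G A A (\<alpha> m)) f}"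
      by (auto simp: action_cat_simps action_fctr_simps)
    ultimately show ?case
      using equivariant_iff by (auto intro!: bij_betw_Collect[OF bij'])
  next
    case (2 X X' A A' h k g)
    then show ?case
      by (cases X; cases X'; cases A; cases A')
        (simp add: action_cat_simps action_fctr_simps natural)
  qed
  then show ?thesis by (auto simp: left_adjoint_iff_adjunction)
qed

text \<open>
  The functor \<open>K\<^sup>M \<rightarrow> K\<close> that only forgets the action is
  \<open>action_forget id_fctr\<close>.
\<close>

definition id_fctr :: "('o, 'a, 'o, 'a) fctr"
  where "id_fctr = \<lparr>ObjMap = \<lambda>X. X, ArrMap = \<lambda>X Y f. f\<rparr>"

lemma action_forget_eq_fctr_comp:
  "action_forget V = fctr_comp (action_forget id_fctr) (action_fctr M V)"
  by (auto simp: action_forget_def fctr_comp_def action_fctr_def id_fctr_def fun_eq_iff)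

lemma cat_functor_action_forget_id_fctr:
  assumes "category K"
  shows "cat_functor (action_cat M K) K (action_forget id_fctr)"
  by (intro cat_functor.intro cat_functor_axioms.intro category_action_cat assms)
    (auto simp: action_forget_def id_fctr_def action_cat_simps)


section \<open>Free actions on sets\<close>

lemma category_Ens: "category (Ens U)"
  by unfold_locales
    (auto simp: Ens_def compose_def fun_eq_iff PiE_iff extensional_def)

text \<open>
  For \<open>S \<in> U\<close> the pairing \<open>pr\<close> is injective on \<open>carrier M \<times> S\<close>, so \<open>inv_into\<close> does decode
  pairs, and \<^const>\<open>zeta_act\<close> and \<^const>\<open>zeta\<close> compute as expected.
\<close>

locale set_universe_monoid = set_universe U pr + monoid M
  for U :: "'u set set" and pr :: "'u \<times> 'u \<Rightarrow> 'u" and M :: "('u, 'z) monoid_scheme" +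
  assumes carrier_in_U: "carrier M \<in> U"
begin

lemma inj_on_pr: "S \<in> U \<Longrightarrow> inj_on pr (carrier M \<times> S)"
  by (rule inj_on_subset[OF inj_pr]) (use carrier_in_U in auto)

lemma zeta_act_pr:
  assumes "S \<in> U" "m \<in> carrier M" "a \<in> carrier M" "s \<in> S"
  shows "zeta_act pr M S m (pr (a, s)) = pr (m \<otimes>\<^bsub>M\<^esub> a, s)"
  using assms by (simp add: zeta_act_def inv_into_f_f[OF inj_on_pr])

lemma ArrMap_zeta_pr:
  assumes "S \<in> U" "a \<in> carrier M" "s \<in> S"
  shows "ArrMap (zeta pr M) S T f (pr (a, s)) = pr (a, f s)"
  using assms by (simp add: zeta_def inv_into_f_f[OF inj_on_pr])

lemma ArrMap_zeta_extensional: "ArrMap (zeta pr M) S T f \<in> extensional (pr ` (carrier M \<times> S))"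
  by (simp add: zeta_def)

lemma zeta_act_in_Hom:
  assumes "S \<in> U" "m \<in> carrier M"
  shows "zeta_act pr M S m \<in> pr ` (carrier M \<times> S) \<rightarrow>\<^sub>E pr ` (carrier M \<times> S)"
proof (rule PiE_I)
  fix x assume "x \<in> pr ` (carrier M \<times> S)"
  with assms show "zeta_act pr M S m x \<in> pr ` (carrier M \<times> S)" by (auto simp: zeta_act_pr)
next
  fix x assume "x \<notin> pr ` (carrier M \<times> S)"
  with assms show "zeta_act pr M S m x = undefined" by (simp add: zeta_act_def)
qed

lemma ArrMap_zeta_in_Hom:
  assumes "S \<in> U" "f \<in> S \<rightarrow>\<^sub>E T"
  shows "ArrMap (zeta pr M) S T f \<in> pr ` (carrier M \<times> S) \<rightarrow>\<^sub>E pr ` (carrier M \<times> T)"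
  using assms ArrMap_zeta_extensional[of S T f]
  by (auto simp: PiE_iff ArrMap_zeta_pr)

lemma ObjMap_zeta: "ObjMap (zeta pr M) S = (pr ` (carrier M \<times> S), zeta_act pr M S)"
  by (simp add: zeta_def)

lemma free_action_ext:
  assumes "f \<in> extensional (pr ` (carrier M \<times> S))" "g \<in> extensional (pr ` (carrier M \<times> S))"
    and "\<And>a s. \<lbrakk>a \<in> carrier M; s \<in> S\<rbrakk> \<Longrightarrow> f (pr (a, s)) = g (pr (a, s))"
  shows "f = g"
  using assms by (intro extensionalityI[of f _ g]) auto

lemma zeta_act_mult:
  assumes "S \<in> U" "m \<in> carrier M" "n \<in> carrier M"
  shows "zeta_act pr M S (m \<otimes>\<^bsub>M\<^esub> n) =
    compose (pr ` (carrier M \<times> S)) (zeta_act pr M S m) (zeta_act pr M S n)"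
  using assms zeta_act_in_Hom[of S "m \<otimes>\<^bsub>M\<^esub> n"]
  by (intro free_action_ext) (auto simp: zeta_act_pr compose_def m_assoc PiE_iff)

lemma zeta_act_one:
  assumes "S \<in> U"
  shows "zeta_act pr M S \<one>\<^bsub>M\<^esub> = (\<lambda>x\<in>pr ` (carrier M \<times> S). x)"
  using assms zeta_act_in_Hom[of S "\<one>\<^bsub>M\<^esub>"]
  by (intro free_action_ext) (auto simp: zeta_act_pr PiE_iff)

lemma cat_functor_zeta: "cat_functor (Ens U) (action_cat M (Ens U)) (zeta pr M)"
proof (intro cat_functor.intro cat_functor_axioms.intro category_action_cat category_Ens,
    goal_cases)
  case (1 S)
  moreover have "zeta_act pr M S \<in> extensional (carrier M)" by (simp add: zeta_act_def)
  ultimately show ?case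
    using carrier_in_U zeta_act_in_Hom
    by (auto simp: ObjMap_zeta action_cat_simps Ens_def prod_in_U zeta_act_mult zeta_act_one)
next
  case (2 S T f)
  then have S: "S \<in> U" "T \<in> U" "f \<in> S \<rightarrow>\<^sub>E T" by (auto simp: Ens_def)
  have "compose (pr ` (carrier M \<times> S)) (ArrMap (zeta pr M) S T f) (zeta_act pr M S m) =
      compose (pr ` (carrier M \<times> S)) (zeta_act pr M T m) (ArrMap (zeta pr M) S T f)"
    if "m \<in> carrier M" for m
    by (rule free_action_ext[of _ S])
      (use S that in \<open>auto simp: compose_def zeta_act_pr ArrMap_zeta_pr PiE_iff\<close>)
  with S show ?case
    by (simp add: ObjMap_zeta action_cat_simps Ens_def ArrMap_zeta_in_Hom)
next
  case (3 S)
  then have "S \<in> U" by (simp add: Ens_def)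
  then show ?case
    by (auto simp: ObjMap_zeta action_cat_simps Ens_def ArrMap_zeta_pr ArrMap_zeta_extensional
        intro!: free_action_ext[of _ S])
next
  case (4 R S T f g)
  then have "R \<in> U" "S \<in> U" "f \<in> R \<rightarrow>\<^sub>E S" by (auto simp: Ens_def)
  then show ?case
    by (auto simp: ObjMap_zeta action_cat_simps Ens_def ArrMap_zeta_pr ArrMap_zeta_extensional
        compose_def PiE_iff intro!: free_action_ext[of _ R])
qed

text \<open>
  The adjunct of an equivariant map \<open>g\<close> on \<open>M \<times> S\<close> is its restriction
  \<open>s \<mapsto> g (\<one>, s)\<close> to the generators. Equivariance forces \<open>g (a, s) = \<phi> a (g (\<one>, s))\<close>, and
  conversely, because \<open>\<phi>\<close> is an action, \<open>(a, s) \<mapsto> \<phi> a (f s)\<close> is an equivariant extension of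
  any map \<open>f\<close> on \<open>S\<close>.
\<close>

lemma left_adjoint_zeta:
  "left_adjoint (Ens U) (action_cat M (Ens U)) (zeta pr M) (action_forget id_fctr)"
proof -
  have "adjunction (Ens U) (action_cat M (Ens U)) (zeta pr M) (action_forget id_fctr)
      (\<lambda>S A g. \<lambda>s\<in>S. g (pr (\<one>\<^bsub>M\<^esub>, s)))"
  proof (intro adjunction.intro adjunction_axioms.intro cat_functor_zeta
      cat_functor_action_forget_id_fctr category_Ens, goal_cases)
    case (1 S A)
    obtain X \<phi> where A: "A = (X, \<phi>)" by fastforce
    let ?MS = "pr ` (carrier M \<times> S)"
    let ?E = "Hom (action_cat M (Ens U)) (ObjMap (zeta pr M) S) A"
    have S: "S \<in> U"
      and \<phi>: "\<And>m. m \<in> carrier M \<Longrightarrow> \<phi> m \<in> X \<rightarrow>\<^sub>E X"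
      and \<phi>_mult: "\<And>m n x. \<lbrakk>m \<in> carrier M; n \<in> carrier M; x \<in> X\<rbrakk>
        \<Longrightarrow> \<phi> (m \<otimes>\<^bsub>M\<^esub> n) x = \<phi> m (\<phi> n x)"
      and \<phi>_one: "\<And>x. x \<in> X \<Longrightarrow> \<phi> \<one>\<^bsub>M\<^esub> x = x"
      using 1 by (auto simp: A action_cat_simps Ens_def compose_def)
    have E_iff: "g \<in> ?E \<longleftrightarrow> g \<in> ?MS \<rightarrow>\<^sub>E X \<and> (\<forall>m\<in>carrier M. \<forall>a\<in>carrier M. \<forall>s\<in>S.
        g (pr (m \<otimes>\<^bsub>M\<^esub> a, s)) = \<phi> m (g (pr (a, s))))" for g
    proof -
      have "compose ?MS g (zeta_act pr M S m) = compose ?MS (\<phi> m) g \<longleftrightarrow>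
          (\<forall>a\<in>carrier M. \<forall>s\<in>S. g (pr (m \<otimes>\<^bsub>M\<^esub> a, s)) = \<phi> m (g (pr (a, s))))"
        if "m \<in> carrier M" for m
      proof -
        have "compose ?MS g (zeta_act pr M S m) = compose ?MS (\<phi> m) g \<longleftrightarrow>
            (\<forall>x\<in>?MS. g (zeta_act pr M S m x) = \<phi> m (g x))"
          by (auto simp: compose_def fun_eq_iff restrict_def)
        also have "\<dots> \<longleftrightarrow> (\<forall>a\<in>carrier M. \<forall>s\<in>S. g (zeta_act pr M S m (pr (a, s))) = \<phi> m (g (pr (a, s))))"
          by blast
        finally show ?thesis using S that by (simp add: zeta_act_pr)
      qed
      then show ?thesis by (simp add: A ObjMap_zeta action_cat_simps Ens_def)
    qed
    define ext where "ext f = (\<lambda>x\<in>?MS. case inv_into (carrier M \<times> S) pr x of (a, s) \<Rightarrow> \<phi> a (f s))"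
      for f :: "'u \<Rightarrow> 'u"
    have ext_pr: "ext f (pr (a, s)) = \<phi> a (f s)" if "a \<in> carrier M" "s \<in> S" for f a s
      using S that by (simp add: ext_def inv_into_f_f[OF inj_on_pr])
    have ext_in_E: "ext f \<in> ?E" if f: "f \<in> S \<rightarrow>\<^sub>E X" for f
    proof -
      have "ext f \<in> extensional ?MS" by (simp add: ext_def)
      moreover have "\<phi> a (f s) \<in> X" if "a \<in> carrier M" "s \<in> S" for a s
        using \<phi>[OF that(1)] f that(2) by auto
      ultimately show ?thesis
        using f by (auto simp: E_iff PiE_iff ext_pr \<phi>_mult)
    qed
    have "bij_betw (\<lambda>g. \<lambda>s\<in>S. g (pr (\<one>\<^bsub>M\<^esub>, s))) ?E (S \<rightarrow>\<^sub>E X)"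
    proof (rule bij_betw_byWitness[where f' = ext])
      show "\<forall>g\<in>?E. ext (\<lambda>s\<in>S. g (pr (\<one>\<^bsub>M\<^esub>, s))) = g"
      proof
        fix g assume "g \<in> ?E"
        have eq: "\<phi> a (g (pr (\<one>\<^bsub>M\<^esub>, s))) = g (pr (a, s))"
          if "a \<in> carrier M" "s \<in> S" for a s
        proof -
          have "\<phi> a (g (pr (\<one>\<^bsub>M\<^esub>, s))) = g (pr (a \<otimes>\<^bsub>M\<^esub> \<one>\<^bsub>M\<^esub>, s))"
            using \<open>g \<in> ?E\<close> that one_closed unfolding E_iff by metis
          then show ?thesis using that by simp
        qed
        show "ext (\<lambda>s\<in>S. g (pr (\<one>\<^bsub>M\<^esub>, s))) = g"
        proof (rule free_action_ext[of _ S])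
          show "ext (\<lambda>s\<in>S. g (pr (\<one>\<^bsub>M\<^esub>, s))) \<in> extensional ?MS" by (simp add: ext_def)
          show "g \<in> extensional ?MS" using \<open>g \<in> ?E\<close> by (simp add: E_iff PiE_iff)
          show "ext (\<lambda>s\<in>S. g (pr (\<one>\<^bsub>M\<^esub>, s))) (pr (a, s)) = g (pr (a, s))"
            if "a \<in> carrier M" "s \<in> S" for a s
            using that by (simp add: ext_pr eq)
        qed
      qed
      show "\<forall>f\<in>S \<rightarrow>\<^sub>E X. (\<lambda>s\<in>S. ext f (pr (\<one>\<^bsub>M\<^esub>, s))) = f"
        by (auto simp: fun_eq_iff restrict_def ext_pr \<phi>_one PiE_iff extensional_def)
      show "(\<lambda>g. \<lambda>s\<in>S. g (pr (\<one>\<^bsub>M\<^esub>, s))) ` ?E \<subseteq> S \<rightarrow>\<^sub>E X"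
        by (auto simp: E_iff PiE_iff)
      show "ext ` (S \<rightarrow>\<^sub>E X) \<subseteq> ?E" using ext_in_E by blast
    qed
    then show ?case by (simp add: A Ens_def action_forget_def id_fctr_def)
  next
    case (2 S S' A A' h k g)
    obtain X \<phi> X' \<phi>' where A: "A = (X, \<phi>)" "A' = (X', \<phi>')" by fastforce
    from 2 have "S \<in> U" "S' \<in> U" "h \<in> S' \<rightarrow>\<^sub>E S" by (auto simp: Ens_def)
    then show ?case
      by (auto simp: A ObjMap_zeta action_cat_simps Ens_def action_forget_def id_fctr_def
          compose_def fun_eq_iff restrict_def ArrMap_zeta_pr PiE_iff)
  qed
  then show ?thesis by (auto simp: left_adjoint_iff_adjunction)
qed

end

theorem theorem4p5:
  fixes U :: "'u set set" and pr :: "'u \<times> 'u \<Rightarrow> 'u"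
    and C :: "('o, 'a) cat" and V :: "('o, 'a, 'u set, 'u \<Rightarrow> 'u) fctr"
    and F :: "('u set, 'u \<Rightarrow> 'u, 'o, 'a) fctr"
    and M :: "('u, 'z) monoid_scheme"
  assumes "set_universe U pr"
    and "concrete_category U C V"
    and "left_adjoint (Ens U) C F V"
    and "monoid M" and "carrier M \<in> U"
  shows "left_adjoint (Ens U) (action_cat M C)
           (fctr_comp (action_fctr M F) (zeta pr M)) (action_forget V)"
proof -
  interpret set_universe_monoid U pr M
    using assms by (intro set_universe_monoid.intro set_universe_monoid_axioms.intro)
  show ?thesis
    unfolding action_forget_eq_fctr_comp[of V M]
    using left_adjoint_zeta left_adjoint_action_fctr[OF assms(4,3)]
    by (rule left_adjoint_fctr_comp)
qed

end
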